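(* Let $G$ be a finite undirected graph (multiple edges and loops allowed), and let $H_1,\dots,H_n$ be a collection of subgraphs of $G$ where no $H_i$ is a subgraph of $H_j$ when $i\neq j$. Then $\bigcup_{i=1}^n\langle \mathrm{id}_{H_i}\rangle$ has basis $\mathcal B=\{H_1,\dots,H_n\}$.
   Context: Graphs are finite and undirected and may have multiple edges and loops; the empty graph $\emptyset$ counts as a graph (and as a subgraph of every graph) and the empty map $\mu_0:\emptyset\to\emptyset$ counts as a graph isomorphism. For a graph $G$, $\mathrm{Fisg}(G)$ is the set of all graph isomorphisms $\varphi:H\to J$ (bijections on vertices and on edges preserving incidence) where $H$ and $J$ are subgraphs of $G$. For $\varphi,\psi\in\mathrm{Fisg}(G)$ the product $\psi\circ\varphi$ is the composition of partial maps, with domain $\varphi^{-1}(\mathrm{Im}(\varphi)\cap\mathrm{Dom}(\psi))$ and image $\psi(\mathrm{Im}(\varphi)\cap\mathrm{Dom}(\psi))$. An ideal of a semigroup $S$ is a subset $I\subseteq S$ with $SI\subseteq I$ and $IS\subseteq I$; unions of ideals are ideals. For $a\in\mathrm{Fisg}(G)$, $a:H\to K$, the ideal generated by $a$ is $\langle a\rangle=\{\varphi\in\mathrm{Fisg}(G)\mid\varphi:L\to M,\ L,M\text{ isomorphic to a subgraph of }H\}$; $\mathrm{id}_H$ is the identity isomorphism of the subgraph $H$. A generating set of graphs of an ideal $I$ of $\mathrm{Fisg}(G)$ is a family $\mathcal B$ of graphs such that (i) for every $a\in I$, $a:H\to K$, the graph $H$ is isomorphic to a subgraph of some $B\in\mathcal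 B$, and (ii) every $B\in\mathcal B$ is the domain of some $\alpha\in I$. A basis of $I$ is a generating set of graphs of $I$ that is minimal (with respect to inclusion).
   Formalization: The hypothesis "no H_i is a subgraph of H_j" is strengthened to "no H_i is isomorphic to a subgraph of H_j"; read literally the claim fails, e.g. for G two isolated vertices and H_1, H_2 the two one-vertex subgraphs. *)

theory Defs
  imports Main
begin

text \<open>
  A finite undirected graph with multiple edges and loops.  The edge set is the domain of the
  incidence map, which sends an edge to its set of endpoints (a singleton for a loop).  As the
  incidence map is partial, two graphs are equal iff they have the same vertices, the same edges
  and the same endpoints.
\<close>

record ('v, 'e) mgraph =
  verts :: "'v set"
  inc :: "'e \<rightharpoonup> 'v set"

definition edges :: "('v, 'e) mgraph \<Rightarrow> 'e set" where
  "edges G = dom (inc G)"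

definition ends :: "('v, 'e) mgraph \<Rightarrow> 'e \<Rightarrow> 'v set" where
  "ends G e = the (inc G e)"

definition is_mgraph :: "('v, 'e) mgraph \<Rightarrow> bool" where
  "is_mgraph G \<longleftrightarrow> finite (verts G) \<and> finite (edges G) \<and>
     (\<forall>e\<in>edges G. ends G e \<subseteq> verts G \<and> card (ends G e) \<in> {1, 2})"

definition subgraph :: "('v, 'e) mgraph \<Rightarrow> ('v, 'e) mgraph \<Rightarrow> bool" where
  "subgraph H G \<longleftrightarrow> is_mgraph H \<and> verts H \<subseteq> verts G \<and> inc H \<subseteq>\<^sub>m inc G"

text \<open>
  A partial map of graphs is a pair of partial maps, on vertices and on edges.
  Here \<open>graph_iso \<phi> H J\<close> says that \<open>\<phi> : H \<rightarrow> J\<close> is a graph isomorphism with domain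
  exactly \<open>H\<close>, so that maps with different domains are different.
\<close>

type_synonym ('v, 'e) gmap = "('v \<rightharpoonup> 'v) \<times> ('e \<rightharpoonup> 'e)"

definition graph_iso :: "('v, 'e) gmap \<Rightarrow> ('v, 'e) mgraph \<Rightarrow> ('v, 'e) mgraph \<Rightarrow> bool" where
  "graph_iso \<phi> H J \<longleftrightarrow>
     dom (fst \<phi>) = verts H \<and> bij_betw (the \<circ> fst \<phi>) (verts H) (verts J) \<and>
     dom (snd \<phi>) = edges H \<and> bij_betw (the \<circ> snd \<phi>) (edges H) (edges J) \<and>
     (\<forall>e\<in>edges H. ends J (the (snd \<phi> e)) = (the \<circ> fst \<phi>) ` ends H e)"

text \<open>
  In a hypothesis such as ``no \<open>H\<^sub>i\<close> is a subgraph of \<open>H\<^sub>j\<close>'', made to obtain a minimal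
  generating set, ``subgraph'' has to be read up to isomorphism: with two different one-vertex
  subgraphs \<open>H\<^sub>1\<close>, \<open>H\<^sub>2\<close> of \<open>G\<close>, the set \<open>{H\<^sub>1, H\<^sub>2}\<close> generates, but so does \<open>{H\<^sub>1}\<close>.
\<close>

definition iso_to_subgraph :: "('v, 'e) mgraph \<Rightarrow> ('v, 'e) mgraph \<Rightarrow> bool" where
  "iso_to_subgraph L H \<longleftrightarrow> (\<exists>K \<phi>. subgraph K H \<and> graph_iso \<phi> L K)"

definition id_iso :: "('v, 'e) mgraph \<Rightarrow> ('v, 'e) gmap" where
  "id_iso H = (Some |` verts H, Some |` edges H)"

definition sub_iso :: "('v, 'e) mgraph \<Rightarrow> ('v, 'e) gmap \<Rightarrow> ('v, 'e) mgraph \<Rightarrow> ('v, 'e) mgraph \<Rightarrow> bool"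
  where "sub_iso G \<phi> H J \<longleftrightarrow> subgraph H G \<and> subgraph J G \<and> graph_iso \<phi> H J"

definition Fisg :: "('v, 'e) mgraph \<Rightarrow> ('v, 'e) gmap set" where
  "Fisg G = {\<phi>. \<exists>H J. sub_iso G \<phi> H J}"

definition gcomp :: "('v, 'e) gmap \<Rightarrow> ('v, 'e) gmap \<Rightarrow> ('v, 'e) gmap" where
  "gcomp \<psi> \<phi> = (fst \<psi> \<circ>\<^sub>m fst \<phi>, snd \<psi> \<circ>\<^sub>m snd \<phi>)"

definition is_ideal :: "('v, 'e) mgraph \<Rightarrow> ('v, 'e) gmap set \<Rightarrow> bool" where
  "is_ideal G I \<longleftrightarrow> I \<subseteq> Fisg G \<and>
     (\<forall>s\<in>Fisg G. \<forall>a\<in>I. gcomp s a \<in> I \<and> gcomp a s \<in> I)"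

text \<open>
  The domain \<open>H\<close> of an element \<open>a\<close> of \<open>Fisg G\<close> is determined by \<open>a\<close> and \<open>G\<close>
  (lemma \<open>sub_iso_unique\<close>), so the quantifier over \<open>H\<close> below is harmless; that the set
  is the least ideal containing \<open>a\<close> is lemma \<open>ideal_gen_eq_Inter\<close>.
\<close>

definition ideal_gen :: "('v, 'e) mgraph \<Rightarrow> ('v, 'e) gmap \<Rightarrow> ('v, 'e) gmap set" where
  "ideal_gen G a = {\<phi>. \<exists>H K L M. sub_iso G a H K \<and> sub_iso G \<phi> L M \<and>
     iso_to_subgraph L H \<and> iso_to_subgraph M H}"

definition generating_graphs ::
  "('v, 'e) mgraph \<Rightarrow> ('v, 'e) gmap set \<Rightarrow> ('v, 'e) mgraph set \<Rightarrow> bool" where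
  "generating_graphs G I \<B> \<longleftrightarrow> is_ideal G I \<and>
     (\<forall>a\<in>I. \<forall>H K. sub_iso G a H K \<longrightarrow> (\<exists>B\<in>\<B>. iso_to_subgraph H B)) \<and>
     (\<forall>B\<in>\<B>. \<exists>\<alpha>\<in>I. \<exists>K. sub_iso G \<alpha> B K)"

definition is_basis ::
  "('v, 'e) mgraph \<Rightarrow> ('v, 'e) gmap set \<Rightarrow> ('v, 'e) mgraph set \<Rightarrow> bool" where
  "is_basis G I \<B> \<longleftrightarrow> generating_graphs G I \<B> \<and> (\<forall>\<B>'. \<B>' \<subset> \<B> \<longrightarrow> \<not> generating_graphs G I \<B>')"

lemma subgraph_eqI:
  assumes "subgraph H G" "subgraph H' G" "verts H = verts H'" "edges H = edges H'"
  shows "H = H'"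
proof -
  have "inc H x = inc H' x" for x
  proof (cases "x \<in> dom (inc H)")
    case True
    then have "inc H x = inc G x" "inc H' x = inc G x"
      using assms by (simp_all add: subgraph_def edges_def map_le_def)
    then show ?thesis by simp
  next
    case False
    then have "x \<notin> dom (inc H')"
      using assms(4) by (simp add: edges_def)
    then show ?thesis using False by (simp add: domIff)
  qed
  then have "inc H = inc H'" by (rule ext)
  then show ?thesis using assms(3) by simp
qed

lemma sub_iso_unique:
  assumes "sub_iso G a H K" "sub_iso G a H' K'"
  shows "H = H'" and "K = K'"
proof -
  have 1: "verts H = verts H'" "edges H = edges H'"
    using assms by (auto simp: sub_iso_def graph_iso_def)
  then show "H = H'" using assms subgraph_eqI by (auto simp: sub_iso_def)
  have "verts K = verts K'" "edges K = edges K'"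
    using assms 1 by (auto simp: sub_iso_def graph_iso_def bij_betw_def)
  then show "K = K'" using assms subgraph_eqI by (auto simp: sub_iso_def)
qed

lemma subgraph_refl: "subgraph H G \<Longrightarrow> subgraph H H"
  by (simp add: subgraph_def)

lemma subgraph_trans: "subgraph K H \<Longrightarrow> subgraph H G \<Longrightarrow> subgraph K G"
  by (auto simp: subgraph_def intro: map_le_trans)

lemma bij_betw_the_iff:
  assumes "dom m = A"
  shows "bij_betw (the \<circ> m) A B \<longleftrightarrow> inj_on m A \<and> ran m = B"
proof -
  have "(the \<circ> m) ` A = ran m"
    using assms by (force simp: ran_def image_iff)
  moreover have "inj_on (the \<circ> m) A \<longleftrightarrow> inj_on m A"
    using assms by (auto simp: inj_on_def domIff option.expand)
  ultimately show ?thesis by (simp add: bij_betw_def)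
qed

lemma graph_iso_iff:
  "graph_iso \<phi> H J \<longleftrightarrow>
     dom (fst \<phi>) = verts H \<and> inj_on (fst \<phi>) (verts H) \<and> ran (fst \<phi>) = verts J \<and>
     dom (snd \<phi>) = edges H \<and> inj_on (snd \<phi>) (edges H) \<and> ran (snd \<phi>) = edges J \<and>
     (\<forall>e e'. snd \<phi> e = Some e' \<longrightarrow> ends J e' = (the \<circ> fst \<phi>) ` ends H e)"
proof -
  have "(\<forall>e\<in>edges H. ends J (the (snd \<phi> e)) = (the \<circ> fst \<phi>) ` ends H e) \<longleftrightarrow>
      (\<forall>e e'. snd \<phi> e = Some e' \<longrightarrow> ends J e' = (the \<circ> fst \<phi>) ` ends H e)"
    if "dom (snd \<phi>) = edges H"
    unfolding that[symmetric] dom_def by auto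
  then show ?thesis
    unfolding graph_iso_def
    by (simp add: bij_betw_the_iff cong: conj_cong)
qed

lemma subgraph_ends: "subgraph H G \<Longrightarrow> e \<in> edges H \<Longrightarrow> ends H e = ends G e"
  by (simp add: edges_def ends_def map_le_def subgraph_def)

lemma subgraph_ends_subset: "subgraph H G \<Longrightarrow> e \<in> edges H \<Longrightarrow> ends H e \<subseteq> verts H"
  by (simp add: is_mgraph_def subgraph_def)

lemma id_iso: "subgraph H G \<Longrightarrow> graph_iso (id_iso H) H H"
  using subgraph_ends_subset[of H G]
  by (fastforce simp: graph_iso_iff id_iso_def inj_on_def ran_def restrict_map_def
      dom_def image_iff split: if_splits)

lemma sub_iso_id: "subgraph H G \<Longrightarrow> sub_iso G (id_iso H) H H"
  by (simp add: sub_iso_def id_iso)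

definition pinv :: "('a \<rightharpoonup> 'a) \<Rightarrow> 'a \<rightharpoonup> 'a" where
  "pinv m y = (if y \<in> ran m then Some (SOME x. m x = Some y) else None)"

lemma pinv_eq_iff:
  assumes "inj_on m (dom m)"
  shows "pinv m y = Some x \<longleftrightarrow> m x = Some y"
proof
  assume "pinv m y = Some x"
  then have y: "y \<in> ran m" and x: "x = (SOME x. m x = Some y)"
    by (simp_all add: pinv_def split: if_split_asm)
  from y have "\<exists>x. m x = Some y" by (simp add: ran_def)
  then show "m x = Some y" unfolding x by (rule someI_ex)
next
  assume x: "m x = Some y"
  have "(SOME x. m x = Some y) = x"
  proof (rule some_equality[where P = "\<lambda>x. m x = Some y", OF x])
    fix z assume z: "m z = Some y"
    show "z = x"
      by (rule inj_onD[OF assms]) (use x z in auto)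
  qed
  then show "pinv m y = Some x" using ranI[of m x y, OF x] by (simp add: pinv_def)
qed

lemma dom_pinv: "dom (pinv m) = ran m"
  by (simp add: pinv_def dom_def)

lemma ran_pinv: "inj_on m (dom m) \<Longrightarrow> ran (pinv m) = dom m"
  by (simp add: ran_def pinv_eq_iff dom_def)

lemma inj_pinv:
  assumes "inj_on m (dom m)"
  shows "inj_on (pinv m) (ran m)"
proof (rule inj_onI)
  fix y z assume "y \<in> ran m" "z \<in> ran m" and eq: "pinv m y = pinv m z"
  then obtain x where "m x = Some y" by (auto simp: ran_def)
  moreover from this have "m x = Some z"
    using eq pinv_eq_iff[OF assms] by metis
  ultimately show "y = z" by simp
qed

definition ginv :: "('v, 'e) gmap \<Rightarrow> ('v, 'e) gmap" where
  "ginv \<phi> = (pinv (fst \<phi>), pinv (snd \<phi>))"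

lemma sub_iso_ginv:
  assumes "sub_iso G \<phi> H J"
  shows "sub_iso G (ginv \<phi>) J H"
proof -
  have H: "subgraph H G" and J: "subgraph J G" and iso: "graph_iso \<phi> H J"
    using assms by (auto simp: sub_iso_def)
  note i = iso[unfolded graph_iso_iff]
  have inj: "inj_on (fst \<phi>) (dom (fst \<phi>))" "inj_on (snd \<phi>) (dom (snd \<phi>))"
    using i by simp_all
  have *: "ends H e = (the \<circ> pinv (fst \<phi>)) ` ends J e'" if e: "snd \<phi> e = Some e'" for e e'
  proof -
    have inv: "(the \<circ> pinv (fst \<phi>)) ((the \<circ> fst \<phi>) x) = x" if x: "x \<in> verts H" for x
    proof -
      obtain y where y: "fst \<phi> x = Some y" using x i by blast
      then have "pinv (fst \<phi>) y = Some x" using pinv_eq_iff[OF inj(1)] by simp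
      with y show ?thesis by simp
    qed
    have "e \<in> edges H" using e i by blast
    then have "ends H e \<subseteq> verts H" using subgraph_ends_subset[OF H] by blast
    then have "(\<lambda>x. (the \<circ> pinv (fst \<phi>)) ((the \<circ> fst \<phi>) x)) ` ends H e = (\<lambda>x. x) ` ends H e"
      using inv by (intro image_cong) auto
    moreover have "ends J e' = (the \<circ> fst \<phi>) ` ends H e" using e i by blast
    ultimately show ?thesis by (simp add: image_image)
  qed
  have "graph_iso (ginv \<phi>) J H"
    unfolding graph_iso_iff ginv_def fst_conv snd_conv dom_pinv
      ran_pinv[OF inj(1)] ran_pinv[OF inj(2)] pinv_eq_iff[OF inj(2)]
    using i * inj_pinv[OF inj(1)] inj_pinv[OF inj(2)] by auto
  then show ?thesis using H J by (simp add: sub_iso_def)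
qed

lemma sub_iso_gcomp:
  assumes \<phi>: "sub_iso G \<phi> L M" and \<psi>: "sub_iso G \<psi> N P"
  obtains A B where "sub_iso G (gcomp \<psi> \<phi>) A B" "subgraph A L" "subgraph B P"
    "verts A = {v \<in> verts L. the (fst \<phi> v) \<in> verts N}"
    "edges A = {e \<in> edges L. the (snd \<phi> e) \<in> edges N}"
proof -
  let ?f = "the \<circ> fst \<phi>" and ?g = "the \<circ> snd \<phi>" and ?f' = "the \<circ> fst \<psi>" and ?g' = "the \<circ> snd \<psi>"
  have L: "subgraph L G" and M: "subgraph M G" and N: "subgraph N G" and P: "subgraph P G"
    and i: "graph_iso \<phi> L M" and j: "graph_iso \<psi> N P"
    using assms by (auto simp: sub_iso_def)
  define VA EA where "VA = {v \<in> verts L. ?f v \<in> verts N}" and "EA = {e \<in> edges L. ?g e \<in> edges N}"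
  define A where "A = \<lparr>verts = VA, inc = inc L |` EA\<rparr>"
  define B where "B = \<lparr>verts = ?f' ` ?f ` VA, inc = inc P |` (?g' ` ?g ` EA)\<rparr>"
  have eA: "edges A = EA" by (auto simp: A_def edges_def EA_def)
  have eB': "?g' ` ?g ` EA \<subseteq> edges P"
    using j by (auto simp: EA_def graph_iso_def bij_betw_def)
  then have eB: "edges B = ?g' ` ?g ` EA" by (auto simp: B_def edges_def)
  have endsA: "ends A e = ends L e" if "e \<in> EA" for e
    using that by (simp add: A_def ends_def)
  have endsB: "ends B e = ends P e" if "e \<in> ?g' ` ?g ` EA" for e
    using that by (simp add: B_def ends_def)
  have fM: "?f ` ends L e = ends N (?g e)" if "e \<in> EA" for e
  proof -
    have "?f ` ends L e = ends M (?g e)" "?g e \<in> edges M"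
      using that i by (auto simp: EA_def graph_iso_def bij_betw_def)
    then show ?thesis
      using that subgraph_ends[OF M] subgraph_ends[OF N] by (simp add: EA_def)
  qed
  have LVA: "ends L e \<subseteq> VA" if "e \<in> EA" for e
  proof -
    have "ends N (?g e) \<subseteq> verts N" "ends L e \<subseteq> verts L"
      using that subgraph_ends_subset[OF N] subgraph_ends_subset[OF L] by (auto simp: EA_def)
    then show ?thesis using fM[OF that] by (auto simp: VA_def)
  qed
  have fP: "ends P (?g' (?g e)) = ?f' ` ?f ` ends L e" if "e \<in> EA" for e
    using that j fM[OF that] by (auto simp: EA_def graph_iso_def)
  have finVA: "finite VA" "finite EA"
    using L by (auto simp: VA_def EA_def subgraph_def is_mgraph_def)
  have "is_mgraph A"
    using L LVA finVA unfolding is_mgraph_def eA subgraph_def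
    by (auto simp: endsA) (auto simp: A_def EA_def)
  then have AL: "subgraph A L"
    by (auto simp: subgraph_def A_def VA_def map_le_def)
  have "is_mgraph B"
    unfolding is_mgraph_def eB
  proof (intro conjI ballI)
    fix e assume e: "e \<in> ?g' ` ?g ` EA"
    then obtain d where d: "d \<in> EA" "e = ?g' (?g d)" by auto
    have "?f' ` ?f ` ends L d \<subseteq> ?f' ` ?f ` VA"
      using LVA[OF d(1)] by (intro image_mono)
    then show "ends B e \<subseteq> verts B"
      using fP[OF d(1)] endsB[OF e] d(2) by (simp add: B_def)
    show "card (ends B e) \<in> {1, 2}"
      using endsB[OF e] P e eB' by (auto simp: subgraph_def is_mgraph_def)
  qed (use finVA in \<open>auto simp: B_def\<close>)
  moreover have "?f' ` ?f ` VA \<subseteq> verts P"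
    using j by (auto simp: VA_def graph_iso_def bij_betw_def)
  ultimately have BP: "subgraph B P"
    by (auto simp: subgraph_def B_def map_le_def)
  have val: "(m' \<circ>\<^sub>m m) x = Some (the (m' (the (m x))))"
    if "x \<in> dom m" "the (m x) \<in> dom m'" for m m' :: "'c \<rightharpoonup> 'c" and x
    using that by auto
  have doms: "dom (m' \<circ>\<^sub>m m) = {x \<in> dom m. the (m x) \<in> dom m'}" for m m' :: "'c \<rightharpoonup> 'c"
    by (auto simp: map_comp_def domIff split: option.splits)
  have bij: "bij_betw (the \<circ> (m' \<circ>\<^sub>m m)) {x \<in> X. the (m x) \<in> Y}
      ((the \<circ> m') ` (the \<circ> m) ` {x \<in> X. the (m x) \<in> Y})"
    if "dom m = X" "dom m' = Y" "inj_on (the \<circ> m) X" "inj_on (the \<circ> m') Y"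
    for m m' :: "'c \<rightharpoonup> 'c" and X Y
  proof -
    let ?Z = "{x \<in> X. the (m x) \<in> Y}"
    have eq: "(the \<circ> (m' \<circ>\<^sub>m m)) x = ((the \<circ> m') \<circ> (the \<circ> m)) x" if "x \<in> ?Z" for x
      using that \<open>dom m = X\<close> \<open>dom m' = Y\<close> by (auto simp: val)
    have "inj_on ((the \<circ> m') \<circ> (the \<circ> m)) ?Z"
      using that(3,4) by (auto simp: inj_on_def)
    then have "bij_betw ((the \<circ> m') \<circ> (the \<circ> m)) ?Z (((the \<circ> m') \<circ> (the \<circ> m)) ` ?Z)"
      by (simp add: bij_betw_def)
    moreover have "bij_betw (the \<circ> (m' \<circ>\<^sub>m m)) ?Z S \<longleftrightarrow> bij_betw ((the \<circ> m') \<circ> (the \<circ> m)) ?Z S" for S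
      by (rule bij_betw_cong) (rule eq)
    ultimately show ?thesis by (simp only: image_comp)
  qed
  have "graph_iso (gcomp \<psi> \<phi>) A B"
    unfolding graph_iso_def eA eB
  proof (intro conjI ballI)
    show "dom (fst (gcomp \<psi> \<phi>)) = verts A" "dom (snd (gcomp \<psi> \<phi>)) = EA"
      using i j by (auto simp: gcomp_def doms A_def VA_def EA_def graph_iso_def)
    show "bij_betw (the \<circ> fst (gcomp \<psi> \<phi>)) (verts A) (verts B)"
      using i j bij[of "fst \<phi>" "verts L" "fst \<psi>" "verts N"]
      by (simp add: gcomp_def A_def B_def VA_def graph_iso_def bij_betw_def)
    show "bij_betw (the \<circ> snd (gcomp \<psi> \<phi>)) EA (?g' ` ?g ` EA)"
      using i j bij[of "snd \<phi>" "edges L" "snd \<psi>" "edges N"]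
      by (simp add: gcomp_def EA_def graph_iso_def bij_betw_def)
    fix e assume e: "e \<in> EA"
    have "the (snd (gcomp \<psi> \<phi>) e) = ?g' (?g e)"
      using e i j by (auto simp: gcomp_def EA_def graph_iso_def val)
    moreover have "(the \<circ> fst (gcomp \<psi> \<phi>)) v = ?f' (?f v)" if "v \<in> VA" for v
      using that i j by (auto simp: gcomp_def VA_def graph_iso_def val)
    then have "(the \<circ> fst (gcomp \<psi> \<phi>)) ` ends L e = ?f' ` ?f ` ends L e"
      using LVA[OF e] by (force simp: image_iff)
    ultimately show "ends B (the (snd (gcomp \<psi> \<phi>) e)) = (the \<circ> fst (gcomp \<psi> \<phi>)) ` ends A e"
      using e fP[OF e] endsA[OF e] endsB by auto
  qed
  then have "sub_iso G (gcomp \<psi> \<phi>) A B"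
    using subgraph_trans[OF AL L] subgraph_trans[OF BP P] by (simp add: sub_iso_def)
  then show ?thesis
    using that AL BP eA by (simp add: A_def VA_def EA_def)
qed

lemma sub_iso_trans:
  assumes "sub_iso G \<phi> L M" "sub_iso G \<psi> N P" "subgraph M N"
  obtains B where "sub_iso G (gcomp \<psi> \<phi>) L B" "subgraph B P"
proof -
  obtain A B where AB: "sub_iso G (gcomp \<psi> \<phi>) A B" "subgraph A L" "subgraph B P"
    "verts A = {v \<in> verts L. the (fst \<phi> v) \<in> verts N}"
    "edges A = {e \<in> edges L. the (snd \<phi> e) \<in> edges N}"
    using sub_iso_gcomp[OF assms(1,2)] .
  have "edges M \<subseteq> edges N" "verts M \<subseteq> verts N"
    using assms(3) by (simp_all add: subgraph_def edges_def map_le_implies_dom_le)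
  then have "verts A = verts L" "edges A = edges L"
    using assms(1) AB(4,5) by (auto simp: sub_iso_def graph_iso_def bij_betw_def)
  then have "A = L"
    using AB(1) assms(1) subgraph_eqI by (auto simp: sub_iso_def)
  then show ?thesis using that AB by blast
qed

lemma iso_to_subgraph_trans:
  assumes "sub_iso G \<phi> L M" "subgraph M N" "subgraph N G" "subgraph H G" "iso_to_subgraph N H"
  shows "iso_to_subgraph L H"
proof -
  obtain K \<psi> where K: "subgraph K H" "graph_iso \<psi> N K"
    using assms(5) by (auto simp: iso_to_subgraph_def)
  then have "sub_iso G \<psi> N K"
    using assms subgraph_trans by (auto simp: sub_iso_def)
  then obtain B where "sub_iso G (gcomp \<psi> \<phi>) L B" "subgraph B K"
    using sub_iso_trans[OF assms(1) _ assms(2)] by metis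
  then show ?thesis
    using K(1) subgraph_trans unfolding iso_to_subgraph_def sub_iso_def by blast
qed

lemma is_ideal_ideal_gen: "is_ideal G (ideal_gen G a)"
  unfolding is_ideal_def
proof (intro conjI ballI)
  show "ideal_gen G a \<subseteq> Fisg G"
    by (auto simp: ideal_gen_def Fisg_def)
  fix s \<phi> assume "s \<in> Fisg G" "\<phi> \<in> ideal_gen G a"
  then obtain N P H K L M where s: "sub_iso G s N P" and a: "sub_iso G a H K"
    and \<phi>: "sub_iso G \<phi> L M" and LM: "iso_to_subgraph L H" "iso_to_subgraph M H"
    by (auto simp: ideal_gen_def Fisg_def)
  have sub: "subgraph H G" "subgraph L G" "subgraph M G"
    using a \<phi> by (auto simp: sub_iso_def)
  obtain A B where 1: "sub_iso G (gcomp s \<phi>) A B" "subgraph A L"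
    using sub_iso_gcomp[OF \<phi> s] by metis
  have "sub_iso G (id_iso A) A A"
    using 1 by (auto simp: sub_iso_def intro: id_iso)
  then have "iso_to_subgraph A H" "iso_to_subgraph B H"
    using 1 iso_to_subgraph_trans[OF _ 1(2) sub(2,1) LM(1)] sub_iso_ginv by blast+
  then show "gcomp s \<phi> \<in> ideal_gen G a"
    using a 1 by (auto simp: ideal_gen_def)
  obtain A B where 2: "sub_iso G (gcomp \<phi> s) A B" "subgraph B M"
    using sub_iso_gcomp[OF s \<phi>] by metis
  have "sub_iso G (id_iso B) B B"
    using 2 by (auto simp: sub_iso_def intro: id_iso)
  then have "iso_to_subgraph A H" "iso_to_subgraph B H"
    using 2 iso_to_subgraph_trans[OF _ 2(2) sub(3,1) LM(2)] by blast+
  then show "gcomp \<phi> s \<in> ideal_gen G a"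
    using a 2 by (auto simp: ideal_gen_def)
qed

lemma ideal_gen_eq_Inter:
  assumes "a \<in> Fisg G"
  shows "ideal_gen G a = \<Inter>{I. is_ideal G I \<and> a \<in> I}"
proof
  obtain H K where a: "sub_iso G a H K"
    using assms by (auto simp: Fisg_def)
  have "sub_iso G (id_iso H) H H"
    using a by (auto simp: sub_iso_def intro: id_iso)
  then have "iso_to_subgraph H H" "iso_to_subgraph K H"
    using sub_iso_ginv[OF a] subgraph_refl unfolding iso_to_subgraph_def sub_iso_def by blast+
  then have "a \<in> ideal_gen G a"
    using a by (auto simp: ideal_gen_def)
  then show "\<Inter>{I. is_ideal G I \<and> a \<in> I} \<subseteq> ideal_gen G a"
    using is_ideal_ideal_gen by blast
  show "ideal_gen G a \<subseteq> \<Inter>{I. is_ideal G I \<and> a \<in> I}"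
  proof clarify
    fix \<phi> I assume "\<phi> \<in> ideal_gen G a" and I: "is_ideal G I" "a \<in> I"
    then obtain L M where \<phi>: "sub_iso G \<phi> L M" and "iso_to_subgraph L H"
      using sub_iso_unique[OF a] by (fastforce simp: ideal_gen_def)
    then obtain L' \<alpha> where L': "subgraph L' H" and "graph_iso \<alpha> L L'"
      by (auto simp: iso_to_subgraph_def)
    then have \<alpha>: "sub_iso G \<alpha> L L'"
      using \<phi> a subgraph_trans by (auto simp: sub_iso_def)
    obtain B where "sub_iso G (gcomp \<phi> (ginv \<alpha>)) L' B"
      using sub_iso_trans[OF sub_iso_ginv[OF \<alpha>] \<phi>] \<phi> subgraph_refl by (metis sub_iso_def)
    then have F: "gcomp \<phi> (ginv \<alpha>) \<in> Fisg G" "ginv a \<in> Fisg G" "\<alpha> \<in> Fisg G"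
      using sub_iso_ginv[OF a] \<alpha> by (auto simp: Fisg_def)
    have comp: "(p \<circ>\<^sub>m pinv m) \<circ>\<^sub>m (pinv q \<circ>\<^sub>m (q \<circ>\<^sub>m m)) = p"
      if h: "dom p = dom m" "inj_on m (dom m)" "inj_on q (dom q)" "ran m \<subseteq> dom q"
      for p m q :: "'c \<rightharpoonup> 'c"
    proof
      fix x
      show "((p \<circ>\<^sub>m pinv m) \<circ>\<^sub>m (pinv q \<circ>\<^sub>m (q \<circ>\<^sub>m m))) x = p x"
      proof (cases "m x")
        case None
        then have "x \<notin> dom p" using h(1) by (simp add: domIff)
        then show ?thesis using None by (simp add: map_comp_def domIff)
      next
        case (Some y)
        moreover from this obtain z where "q y = Some z"
          using h(4) by (auto simp: ran_def)
        moreover have "pinv q z = Some y" "pinv m y = Some x"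
          using h calculation by (auto simp: pinv_eq_iff)
        ultimately show ?thesis by (simp add: map_comp_def)
      qed
    qed
    have "edges L' \<subseteq> edges H" "verts L' \<subseteq> verts H"
      using L' by (simp_all add: subgraph_def edges_def map_le_implies_dom_le)
    then have "gcomp (gcomp \<phi> (ginv \<alpha>)) (gcomp (ginv a) (gcomp a \<alpha>)) = \<phi>"
      using \<phi> \<alpha> a unfolding sub_iso_def graph_iso_iff
      by (intro prod_eqI) (simp_all add: gcomp_def ginv_def comp)
    moreover have "gcomp (gcomp \<phi> (ginv \<alpha>)) (gcomp (ginv a) (gcomp a \<alpha>)) \<in> I"
      using I F by (simp add: is_ideal_def)
    ultimately show "\<phi> \<in> I" by simp
  qed
qed

end

theory Submission
  imports Defs
begin

text \<open>Each \<open>id_iso (H i)\<close> lies in the union and has domain \<open>H i\<close>,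
  while the domain of any element of the union embeds in some \<open>H i\<close>
  (\<open>iso_to_subgraph_if_in_ideal_gen_id\<close>); so the \<open>H i\<close> generate. If a
  generating subfamily omitted \<open>H i\<close>, then \<open>H i\<close>, being the domain of
  \<open>id_iso (H i)\<close>, would have to embed in a remaining \<open>H j\<close>, which the
  hypothesis forbids.\<close>

lemma is_ideal_UN:
  assumes "\<And>x. x \<in> X \<Longrightarrow> is_ideal G (I x)"
  shows "is_ideal G (\<Union>x\<in>X. I x)"
  using assms unfolding is_ideal_def by blast

text \<open>An intersection of ideals that all contain the element contains it too, so no embedding
  of \<open>H\<close> into itself has to be exhibited.\<close>

lemma id_iso_in_ideal_gen:
  assumes "subgraph H G"
  shows "id_iso H \<in> ideal_gen G (id_iso H)"
proof -
  have "id_iso H \<in> Fisg G"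
    using sub_iso_id[OF assms] by (auto simp: Fisg_def)
  then show ?thesis
    by (simp add: ideal_gen_eq_Inter)
qed

text \<open>The definition of \<open>ideal_gen\<close> only provides some domains for the two maps;
  since a map determines its domain, they are \<open>H\<close> and \<open>L\<close>.\<close>

lemma iso_to_subgraph_if_in_ideal_gen_id:
  assumes "subgraph H G" "a \<in> ideal_gen G (id_iso H)" "sub_iso G a L M"
  shows "iso_to_subgraph L H"
proof -
  obtain H' K' L' M' where *: "sub_iso G (id_iso H) H' K'" "sub_iso G a L' M'"
    "iso_to_subgraph L' H'"
    using assms(2) by (auto simp: ideal_gen_def)
  have "H' = H" "L' = L"
    using sub_iso_unique(1)[OF *(1) sub_iso_id[OF assms(1)]]
      sub_iso_unique(1)[OF *(2) assms(3)] by simp_all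
  with *(3) show ?thesis by simp
qed

theorem proposition4p14:
  fixes G :: "('v, 'e) mgraph" and H :: "nat \<Rightarrow> ('v, 'e) mgraph" and n :: nat
  assumes "is_mgraph G"
    and "\<And>i. i \<in> {1..n} \<Longrightarrow> subgraph (H i) G"
    and "\<And>i j. i \<in> {1..n} \<Longrightarrow> j \<in> {1..n} \<Longrightarrow> i \<noteq> j \<Longrightarrow> \<not> iso_to_subgraph (H i) (H j)"
  shows "is_basis G (\<Union>i\<in>{1..n}. ideal_gen G (id_iso (H i))) (H ` {1..n})"
proof -
  let ?I = "\<Union>i\<in>{1..n}. ideal_gen G (id_iso (H i))"
  \<comment> \<open>The identities serve twice: as witnesses that each \<open>H i\<close> is a
    domain, and as test elements for minimality.\<close>
  have id: "id_iso (H i) \<in> ?I" "sub_iso G (id_iso (H i)) (H i) (H i)" if "i \<in> {1..n}" for i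
  proof -
    have "subgraph (H i) G"
      using that by (rule assms(2))
    then show "id_iso (H i) \<in> ?I" "sub_iso G (id_iso (H i)) (H i) (H i)"
      using that by (auto intro: id_iso_in_ideal_gen sub_iso_id)
  qed
  have "generating_graphs G ?I (H ` {1..n})"
    unfolding generating_graphs_def
  proof (intro conjI ballI allI impI)
    show "is_ideal G ?I"
      by (intro is_ideal_UN is_ideal_ideal_gen)
    show "\<exists>B\<in>H ` {1..n}. iso_to_subgraph L B" if "a \<in> ?I" "sub_iso G a L M" for a L M
    proof -
      obtain i where i: "i \<in> {1..n}" "a \<in> ideal_gen G (id_iso (H i))"
        using \<open>a \<in> ?I\<close> by (rule UN_E)
      then have "iso_to_subgraph L (H i)"
        using iso_to_subgraph_if_in_ideal_gen_id[OF assms(2) _ \<open>sub_iso G a L M\<close>] by simp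
      with i(1) show ?thesis by (rule rev_bexI[OF imageI])
    qed
    show "\<exists>\<alpha>\<in>?I. \<exists>K. sub_iso G \<alpha> B K" if "B \<in> H ` {1..n}" for B
    proof -
      obtain i where "i \<in> {1..n}" "B = H i"
        using \<open>B \<in> H ` {1..n}\<close> by (rule imageE)
      then show ?thesis using id[of i] by (intro bexI exI) simp_all
    qed
  qed
  moreover have "\<not> generating_graphs G ?I \<B>" if "\<B> \<subset> H ` {1..n}" for \<B>
  proof
    assume gen: "generating_graphs G ?I \<B>"
    obtain i where i: "i \<in> {1..n}" "H i \<notin> \<B>"
      using \<open>\<B> \<subset> H ` {1..n}\<close> by blast
    \<comment> \<open>Condition (i) of a generating set, applied to
      \<open>id_iso (H i)\<close>.\<close>
    then obtain B where "B \<in> \<B>" "iso_to_subgraph (H i) B"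
      using gen[unfolded generating_graphs_def] id[OF i(1)] by meson
    then obtain j where "j \<in> {1..n}" "H j \<in> \<B>" "iso_to_subgraph (H i) (H j)"
      using \<open>\<B> \<subset> H ` {1..n}\<close> by blast
    \<comment> \<open>Here \<open>i \<noteq> j\<close>, because \<B> contains \<open>H j\<close> but
      not \<open>H i\<close>.\<close>
    then show False
      using i assms(3) by metis
  qed
  ultimately show ?thesis
    by (simp add: is_basis_def)
qed

end
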